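(* Suppose $f_1,\dots,f_n$ satisfy the strong convexity and smoothness assumption (S) of the context, and consider the method SVRG-2BBS described in the context, with multipliers satisfying $\xi_t\in(\underline\xi,\overline\xi)$ for all iterations, where $0<\underline\xi\le\overline\xi$. Suppose the variance condition (V) of the context holds with constant $\alpha>0$. Let $$\eta_0=\frac{\underline\xi}{m_1L},\qquad \eta_1=\frac{\overline\xi}{m_1\mu},$$ and assume $1-\eta_1L(2\alpha+1)>0$ and $1-2\eta_0\mu(1-\eta_1L(2\alpha+1))\in[0,1)$. Let $w_*$ be the minimizer of $F$. Then for every $k\ge1$ $$\mathbb{E}[\|\tilde w_k-w_*\|^2]\le\tilde\gamma^{\,k}\,\|\tilde w_0-w_*\|^2,$$ where $$\tilde\gamma=\big(1-2\eta_0\mu(1-\eta_1L(2\alpha+1))\big)^m+\frac{2\alpha\eta_1^2L^2}{\eta_0\mu(1-\eta_1L(2\alpha+1))}.$$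
   Context: Let $F(w)=\frac1n\sum_{i=1}^n f_i(w)$, $w\in\mathbb{R}^d$, with $f_i:\mathbb{R}^d\to\mathbb{R}$ twice continuously differentiable. $\|\cdot\|$ is the Euclidean norm. Assumption (S): for each $i$ there is $\mu_i>0$ with $f_i(w)\ge f_i(z)+\nabla f_i(z)^T(w-z)+\frac{\mu_i}{2}\|z-w\|^2$ for all $w,z\in\mathbb{R}^d$, and there is $L>0$ with $\|\nabla f_i(w)-\nabla f_i(z)\|\le L\|w-z\|$ for all $i$ and all $w,z$. Put $\mu=\min_i\mu_i$, so $F$ is $\mu$-strongly convex with $L$-Lipschitz gradient. SVRG-2BBS: fix an epoch length $m\ge1$, a constant $m_1>0$, deterministic multipliers $\xi_t>0$ (one per inner iteration), and initial points $\tilde w_{-1}\ne\tilde w_0$ in $\mathbb{R}^d$. In epoch $k=1,2,\dots$: set $\tilde w=\tilde w_{k-1}$, $\tilde g=\nabla F(\tilde w)$, $w_0=\tilde w$, $s^{k-1}=\tilde w_{k-1}-\tilde w_{k-2}$ (assumed nonzero, so that the formulas below are defined), and for $i=1,\dots,n$ $$\tilde A^{k-1}_i=\frac{(s^{k-1})^T(\nabla f_i(\tilde w_{k-1})-\nabla f_i(\tilde w_{k-2}))}{\|s^{k-1}\|^2}\,I,\qquad \tilde A^{k-1}=\frac1n\sum_{i=1}^n\tilde A^{k-1}_i .$$ For $t=1,\dots,m$: pick $i_t\in\{1,\dots,n\}$ uniformly at random, independently of the past, and set $w_t=w_{t-1}-\eta^t_kv_t$, where $$v_t=\nabla f_{i_t}(w_{t-1})-\nabla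 f_{i_t}(\tilde w)+\tilde g+(\tilde A^{k-1}-\tilde A^{k-1}_{i_t})(w_{t-1}-\tilde w),$$ $$\eta^t_k=\frac{\xi_t}{m_1}\,\frac{\|\tilde w_{k-1}-\tilde w_{k-2}\|^2}{(\tilde w_{k-1}-\tilde w_{k-2})^T(\nabla F(\tilde w_{k-1})-\nabla F(\tilde w_{k-2}))}.$$ At the end of the epoch set $\tilde w_k=w_m$. Condition (V) with constant $\alpha>0$: for all epochs $k$ and all $t$, $$\mathbb{E}\big[\|\nabla f_{i_t}(w_{t-1})-\nabla f_{i_t}(\tilde w)-\tilde A^{k-1}_{i_t}(w_{t-1}-\tilde w)\|^2\big]\le\alpha\,\mathbb{E}\big[\|\nabla f_{i_t}(w_{t-1})-\nabla f_{i_t}(\tilde w)\|^2\big],$$ where here $\mathbb{E}$ is the expectation over $i_t$ conditional on the past (in particular on $w_{t-1}$ and $\tilde w$). In the conclusion, $\mathbb{E}$ is the expectation over all random choices. *)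

theory Defs
  imports "HOL-Probability.Probability"
begin

definition grad :: "('a::euclidean_space \<Rightarrow> real) \<Rightarrow> 'a \<Rightarrow> 'a" where
  "grad f x = (THE D. GDERIV f x :> D)"

definition twice_cont_diff :: "('a::euclidean_space \<Rightarrow> real) \<Rightarrow> bool" where
  "twice_cont_diff f \<longleftrightarrow>
     (\<exists>(f' :: 'a \<Rightarrow> 'a \<Rightarrow>\<^sub>L real) (f'' :: 'a \<Rightarrow> 'a \<Rightarrow>\<^sub>L ('a \<Rightarrow>\<^sub>L real)).
        (\<forall>x. (f has_derivative blinfun_apply (f' x)) (at x)) \<and>
        (\<forall>x. (f' has_derivative blinfun_apply (f'' x)) (at x)) \<and>
        continuous_on UNIV f'')"

text \<open>The components are \<open>f 1, \<dots>, f n\<close>; values of \<open>f\<close> at other indices are never used.\<close>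

definition avg_fun :: "nat \<Rightarrow> (nat \<Rightarrow> 'a \<Rightarrow> real) \<Rightarrow> 'a \<Rightarrow> real" where
  "avg_fun n f w = (1 / real n) * (\<Sum>i=1..n. f i w)"

definition strong_convexity :: "('a::euclidean_space \<Rightarrow> real) \<Rightarrow> real \<Rightarrow> bool" where
  "strong_convexity g \<mu> \<longleftrightarrow>
     (\<forall>w z. g w \<ge> g z + grad g z \<bullet> (w - z) + \<mu> / 2 * (norm (z - w))\<^sup>2)"

definition lipschitz_grad :: "('a::euclidean_space \<Rightarrow> real) \<Rightarrow> real \<Rightarrow> bool" where
  "lipschitz_grad g L \<longleftrightarrow> (\<forall>w z. norm (grad g w - grad g z) \<le> L * norm (w - z))"

text \<open>
  In what follows \<open>p\<close> and \<open>c\<close> are the previous and the current snapshot: during epoch \<open>k\<close>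
  they are the snapshots of index \<open>k - 2\<close> and \<open>k - 1\<close>.
\<close>

definition bb_matrix ::
    "(real ^ 'd \<Rightarrow> real) \<Rightarrow> real ^ 'd \<Rightarrow> real ^ 'd \<Rightarrow> real ^ 'd ^ 'd" where
  "bb_matrix g p c =
     (((c - p) \<bullet> (grad g c - grad g p)) / (norm (c - p))\<^sup>2) *\<^sub>R mat 1"

definition bb_matrix_avg ::
    "nat \<Rightarrow> (nat \<Rightarrow> real ^ 'd \<Rightarrow> real) \<Rightarrow> real ^ 'd \<Rightarrow> real ^ 'd \<Rightarrow> real ^ 'd ^ 'd" where
  "bb_matrix_avg n f p c = (1 / real n) *\<^sub>R (\<Sum>i=1..n. bb_matrix (f i) p c)"

definition bb_step ::
    "nat \<Rightarrow> (nat \<Rightarrow> real ^ 'd \<Rightarrow> real) \<Rightarrow> real \<Rightarrow> real \<Rightarrow> real ^ 'd \<Rightarrow> real ^ 'd \<Rightarrow> real" where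
  "bb_step n f m\<^sub>1 x p c =
     x / m\<^sub>1 * ((norm (c - p))\<^sup>2 /
       ((c - p) \<bullet> (grad (avg_fun n f) c - grad (avg_fun n f) p)))"

definition svrg_direction ::
    "nat \<Rightarrow> (nat \<Rightarrow> real ^ 'd \<Rightarrow> real) \<Rightarrow> real ^ 'd \<Rightarrow> real ^ 'd \<Rightarrow> nat \<Rightarrow> real ^ 'd \<Rightarrow> real ^ 'd" where
  "svrg_direction n f p c i w =
     grad (f i) w - grad (f i) c + grad (avg_fun n f) c
       + (bb_matrix_avg n f p c - bb_matrix (f i) p c) *v (w - c)"

text \<open>
  The multipliers \<open>\<xi> k t\<close> and the sampled indices \<open>\<iota> k t\<close> are indexed by the epoch
  \<open>k \<ge> 1\<close> and the inner iteration \<open>t \<in> {1..m}\<close>; \<open>svrg_inner\<close> receives those of one epoch.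
\<close>

primrec svrg_inner ::
    "nat \<Rightarrow> (nat \<Rightarrow> real ^ 'd \<Rightarrow> real) \<Rightarrow> real \<Rightarrow> (nat \<Rightarrow> real) \<Rightarrow> real ^ 'd \<Rightarrow> real ^ 'd
      \<Rightarrow> (nat \<Rightarrow> nat) \<Rightarrow> nat \<Rightarrow> real ^ 'd" where
  "svrg_inner n f m\<^sub>1 \<xi> p c \<iota> 0 = c"
| "svrg_inner n f m\<^sub>1 \<xi> p c \<iota> (Suc t) =
     svrg_inner n f m\<^sub>1 \<xi> p c \<iota> t
       - bb_step n f m\<^sub>1 (\<xi> (Suc t)) p c
           *\<^sub>R svrg_direction n f p c (\<iota> (Suc t)) (svrg_inner n f m\<^sub>1 \<xi> p c \<iota> t)"

text \<open>
  \<open>svrg_state \<dots> k\<close> is the pair of the snapshots of index \<open>k - 1\<close> and \<open>k\<close>, so that the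
  snapshot of index \<open>-1\<close> is the first component at \<open>k = 0\<close>.
\<close>

primrec svrg_state ::
    "nat \<Rightarrow> (nat \<Rightarrow> real ^ 'd \<Rightarrow> real) \<Rightarrow> nat \<Rightarrow> real \<Rightarrow> (nat \<Rightarrow> nat \<Rightarrow> real)
      \<Rightarrow> real ^ 'd \<Rightarrow> real ^ 'd \<Rightarrow> (nat \<Rightarrow> nat \<Rightarrow> nat) \<Rightarrow> nat \<Rightarrow> (real ^ 'd) \<times> (real ^ 'd)" where
  "svrg_state n f m m\<^sub>1 \<xi> wm1 w0 \<iota> 0 = (wm1, w0)"
| "svrg_state n f m m\<^sub>1 \<xi> wm1 w0 \<iota> (Suc k) =
     (case svrg_state n f m m\<^sub>1 \<xi> wm1 w0 \<iota> k of
        (p, c) \<Rightarrow> (c, svrg_inner n f m\<^sub>1 (\<xi> (Suc k)) p c (\<iota> (Suc k)) m))"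

definition snapshot_prev ::
    "nat \<Rightarrow> (nat \<Rightarrow> real ^ 'd \<Rightarrow> real) \<Rightarrow> nat \<Rightarrow> real \<Rightarrow> (nat \<Rightarrow> nat \<Rightarrow> real)
      \<Rightarrow> real ^ 'd \<Rightarrow> real ^ 'd \<Rightarrow> (nat \<Rightarrow> nat \<Rightarrow> nat) \<Rightarrow> nat \<Rightarrow> real ^ 'd" where
  "snapshot_prev n f m m\<^sub>1 \<xi> wm1 w0 \<iota> k = fst (svrg_state n f m m\<^sub>1 \<xi> wm1 w0 \<iota> k)"

definition snapshot ::
    "nat \<Rightarrow> (nat \<Rightarrow> real ^ 'd \<Rightarrow> real) \<Rightarrow> nat \<Rightarrow> real \<Rightarrow> (nat \<Rightarrow> nat \<Rightarrow> real)
      \<Rightarrow> real ^ 'd \<Rightarrow> real ^ 'd \<Rightarrow> (nat \<Rightarrow> nat \<Rightarrow> nat) \<Rightarrow> nat \<Rightarrow> real ^ 'd" where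
  "snapshot n f m m\<^sub>1 \<xi> wm1 w0 \<iota> k = snd (svrg_state n f m m\<^sub>1 \<xi> wm1 w0 \<iota> k)"

definition inner_iterate ::
    "nat \<Rightarrow> (nat \<Rightarrow> real ^ 'd \<Rightarrow> real) \<Rightarrow> nat \<Rightarrow> real \<Rightarrow> (nat \<Rightarrow> nat \<Rightarrow> real)
      \<Rightarrow> real ^ 'd \<Rightarrow> real ^ 'd \<Rightarrow> (nat \<Rightarrow> nat \<Rightarrow> nat) \<Rightarrow> nat \<Rightarrow> nat \<Rightarrow> real ^ 'd" where
  "inner_iterate n f m m\<^sub>1 \<xi> wm1 w0 \<iota> k t =
     svrg_inner n f m\<^sub>1 (\<xi> k)
       (snapshot_prev n f m m\<^sub>1 \<xi> wm1 w0 \<iota> (k - 1)) (snapshot n f m m\<^sub>1 \<xi> wm1 w0 \<iota> (k - 1))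
       (\<iota> k) t"

definition uniform_iid_indices ::
    "'w measure \<Rightarrow> nat \<Rightarrow> nat \<Rightarrow> (nat \<Rightarrow> nat \<Rightarrow> 'w \<Rightarrow> nat) \<Rightarrow> bool" where
  "uniform_iid_indices M n m I \<longleftrightarrow>
     prob_space.indep_vars M (\<lambda>_. count_space UNIV) (\<lambda>(k, t). I k t) ({1..} \<times> {1..m}) \<and>
     (\<forall>k\<ge>1. \<forall>t\<in>{1..m}. distr M (count_space UNIV) (I k t) = measure_pmf (pmf_of_set {1..n}))"

definition past_indices :: "nat \<Rightarrow> nat \<Rightarrow> nat \<Rightarrow> (nat \<times> nat) set" where
  "past_indices m k t = {(j, s). 1 \<le> j \<and> 1 \<le> s \<and> s \<le> m \<and> (j < k \<or> j = k \<and> s < t)}"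

text \<open>
  The sigma-algebra generated by all indices drawn before inner iteration \<open>t\<close> of epoch \<open>k\<close>.
\<close>

definition past_algebra ::
    "'w measure \<Rightarrow> nat \<Rightarrow> (nat \<Rightarrow> nat \<Rightarrow> 'w \<Rightarrow> nat) \<Rightarrow> nat \<Rightarrow> nat \<Rightarrow> 'w measure" where
  "past_algebra M m I k t =
     vimage_algebra (space M) (\<lambda>\<omega>. \<lambda>(j, s)\<in>past_indices m k t. I j s \<omega>)
       (PiM (past_indices m k t) (\<lambda>_. count_space UNIV))"

definition variance_condition ::
    "'w measure \<Rightarrow> nat \<Rightarrow> (nat \<Rightarrow> real ^ 'd \<Rightarrow> real) \<Rightarrow> nat \<Rightarrow> real \<Rightarrow> (nat \<Rightarrow> nat \<Rightarrow> real)
      \<Rightarrow> real ^ 'd \<Rightarrow> real ^ 'd \<Rightarrow> (nat \<Rightarrow> nat \<Rightarrow> 'w \<Rightarrow> nat) \<Rightarrow> real \<Rightarrow> bool" where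
  "variance_condition M n f m m\<^sub>1 \<xi> wm1 w0 I \<alpha> \<longleftrightarrow>
     (\<forall>k\<ge>1. \<forall>t\<in>{1..m}.
        let i = I k t;
            w = (\<lambda>\<omega>. inner_iterate n f m m\<^sub>1 \<xi> wm1 w0 (\<lambda>k t. I k t \<omega>) k (t - 1));
            p = (\<lambda>\<omega>. snapshot_prev n f m m\<^sub>1 \<xi> wm1 w0 (\<lambda>k t. I k t \<omega>) (k - 1));
            c = (\<lambda>\<omega>. snapshot n f m m\<^sub>1 \<xi> wm1 w0 (\<lambda>k t. I k t \<omega>) (k - 1))
        in AE \<omega> in M.
             real_cond_exp M (past_algebra M m I k t)
               (\<lambda>\<omega>. (norm (grad (f (i \<omega>)) (w \<omega>) - grad (f (i \<omega>)) (c \<omega>)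
                       - bb_matrix (f (i \<omega>)) (p \<omega>) (c \<omega>) *v (w \<omega> - c \<omega>)))\<^sup>2) \<omega>
             \<le> \<alpha> * real_cond_exp M (past_algebra M m I k t)
               (\<lambda>\<omega>. (norm (grad (f (i \<omega>)) (w \<omega>) - grad (f (i \<omega>)) (c \<omega>)))\<^sup>2) \<omega>)"

end

theory Submission imports Defs begin

text \<open>
  Write \<open>G\<close> for the gradient of the average \<open>F\<close> and \<open>X\<^sub>i = \<nabla>f\<^sub>i(w) - \<nabla>f\<^sub>i(c) - A\<^sub>i (w - c)\<close> for the part
  of a component gradient difference that the Barzilai-Borwein model misses, where \<open>w\<close> is the inner
  iterate and \<open>c\<close> the snapshot.  The search direction equals \<open>G(w) + (X\<^sub>i - avg X)\<close>: it is the full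
  gradient plus centred noise (\<open>svrg_direction_eq\<close>).  Averaging over the index therefore gives
  \<open>avg \<parallel>w - \<eta> v\<^sub>i - z\<parallel>\<^sup>2 \<le> \<parallel>w - \<eta> G(w) - z\<parallel>\<^sup>2 + \<eta>\<^sup>2 avg \<parallel>X\<^sub>i\<parallel>\<^sup>2\<close> (\<open>avg_svrg_step\<close>), with \<open>z\<close> the
  minimizer.  The variance condition replaces \<open>X\<^sub>i\<close> by \<open>\<nabla>f\<^sub>i(w) - \<nabla>f\<^sub>i(c)\<close> at the cost of the factor \<open>\<alpha>\<close>.
  Cocoercivity of the gradients bounds both \<open>\<parallel>G(w)\<parallel>\<^sup>2\<close> and the part of this difference at \<open>w\<close> by
  multiples of the inner product of \<open>G(w)\<close> and \<open>w - z\<close>, which the descent term outweighs when the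
  steps are short; strong monotonicity turns what is left into a multiple of \<open>\<parallel>w - z\<parallel>\<^sup>2\<close>, and the part
  at \<open>c\<close> remains as an error proportional to \<open>\<parallel>c - z\<parallel>\<^sup>2\<close> (\<open>descent_with_variance_contracts\<close>).  The
  Barzilai-Borwein quotient lies between \<open>1 / L\<close> and \<open>1 / \<mu>\<close>, so the step sizes lie between \<open>\<eta>\<^sub>0\<close> and
  \<open>\<eta>\<^sub>1\<close> (\<open>bb_step_bounds\<close>).

  With \<open>\<rho> = 1 - 2 \<eta>\<^sub>0 \<mu> (1 - \<eta>\<^sub>1 L (2 \<alpha> + 1))\<close> the result is an affine recursion in the inner steps,
  \<open>E \<parallel>w\<^sub>t - z\<parallel>\<^sup>2 \<le> \<rho> E \<parallel>w\<^sub>t\<^sub>-\<^sub>1 - z\<parallel>\<^sup>2 + 2 \<alpha> \<eta>\<^sub>1\<^sup>2 L\<^sup>2 E \<parallel>c - z\<parallel>\<^sup>2\<close> (\<open>expected_inner_step\<close>).  Since \<open>w\<^sub>0 = c\<close>,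
  solving it over one epoch gives the factor \<open>\<rho>\<^sup>m + 2 \<alpha> \<eta>\<^sub>1\<^sup>2 L\<^sup>2 / (1 - \<rho>)\<close>, and epochs compose.

  All iterates before a draw are functions of the finitely many earlier indices.  For such functions
  the passage between a sampled index and the average over all indices follows from independence
  under full expectations (\<open>expectation_fresh_index\<close>); conditional expectations enter only through
  the variance condition, and are integrated out at once against the square of the step size, which
  is itself a function of the past (\<open>weighted_residual_bound\<close>).
\<close>

section \<open>Gradients and smooth convex functions\<close>

lemma grad_eqI:
  assumes "GDERIV g x :> D"
  shows "grad g x = D"
proof -
  have "D' = D" if "GDERIV g x :> D'" for D'
  proof -
    have "(\<lambda>h. h \<bullet> D') = (\<lambda>h. h \<bullet> D)"
      using that assms unfolding gderiv_def by (rule has_derivative_unique)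
    then have "(D' - D) \<bullet> (D' - D) = 0"
      by (metis inner_diff_right right_minus_eq)
    then show ?thesis by simp
  qed
  then show ?thesis
    unfolding grad_def using assms by (intro the_equality)
qed

lemma twice_cont_diff_GDERIV:
  assumes "twice_cont_diff g"
  shows "GDERIV g x :> grad g x"
proof -
  obtain g' where g': "(g has_derivative blinfun_apply (g' x)) (at x)"
    using assms unfolding twice_cont_diff_def by blast
  define D where "D = (\<Sum>b\<in>Basis. blinfun_apply (g' x) b *\<^sub>R b)"
  have lin: "linear (blinfun_apply (g' x))"
    by (simp add: blinfun.bounded_linear_right bounded_linear.linear)
  have "blinfun_apply (g' x) h = h \<bullet> D" for h
  proof -
    have "blinfun_apply (g' x) h = blinfun_apply (g' x) (\<Sum>b\<in>Basis. (h \<bullet> b) *\<^sub>R b)"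
      by (simp add: euclidean_representation)
    also have "\<dots> = (\<Sum>b\<in>Basis. (h \<bullet> b) * blinfun_apply (g' x) b)"
      by (simp add: linear_sum[OF lin] linear_cmul[OF lin])
    also have "\<dots> = h \<bullet> D"
      by (simp add: D_def inner_sum_right mult.commute)
    finally show ?thesis .
  qed
  then have "GDERIV g x :> D"
    using g' unfolding gderiv_def by presburger
  then show ?thesis using grad_eqI by metis
qed

text \<open>
  Along the segment from \<open>x\<close> to \<open>y\<close> the gap between \<open>g\<close> and the quadratic on the right has a
  nonpositive derivative.
\<close>

lemma lipschitz_grad_descent:
  assumes g: "\<And>x. GDERIV g x :> grad g x" and lip: "lipschitz_grad g L"
  shows "g y \<le> g x + grad g x \<bullet> (y - x) + L / 2 * (norm (y - x))\<^sup>2"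
proof -
  define d where "d = y - x"
  define p where "p = (\<lambda>s::real. g (x + s *\<^sub>R d) - s * (grad g x \<bullet> d) - L / 2 * s\<^sup>2 * (norm d)\<^sup>2)"
  have "p 1 \<le> p 0"
  proof (rule DERIV_nonpos_imp_nonincreasing[where f = p and a = 0 and b = 1])
    fix s :: real assume s: "0 \<le> s" "s \<le> 1"
    let ?z = "x + s *\<^sub>R d"
    have g': "(g has_derivative (\<lambda>h. h \<bullet> grad g ?z)) (at ?z)"
      using g[of ?z] by (simp add: gderiv_def)
    have "((\<lambda>s. x + s *\<^sub>R d) has_derivative (\<lambda>h. h *\<^sub>R d)) (at s)"
      by (auto intro!: derivative_eq_intros)
    from has_derivative_compose[OF this g']
    have "((\<lambda>s. g (x + s *\<^sub>R d)) has_real_derivative grad g ?z \<bullet> d) (at s)"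
      unfolding has_field_derivative_def
      by (rule has_derivative_eq_rhs) (auto simp: inner_commute)
    then have "(p has_real_derivative
        grad g ?z \<bullet> d - grad g x \<bullet> d - L * s * (norm d)\<^sup>2) (at s)"
      unfolding p_def by (auto intro!: derivative_eq_intros)
    moreover have "grad g ?z \<bullet> d - grad g x \<bullet> d - L * s * (norm d)\<^sup>2 \<le> 0"
    proof -
      have "grad g ?z \<bullet> d - grad g x \<bullet> d \<le> norm (grad g ?z - grad g x) * norm d"
        by (metis inner_diff_left norm_cauchy_schwarz)
      also have "\<dots> \<le> L * norm (?z - x) * norm d"
        using lip unfolding lipschitz_grad_def by (intro mult_right_mono norm_ge_zero) blast
      also have "\<dots> = L * s * (norm d)\<^sup>2"
        using s by (simp add: power2_eq_square)
      finally show ?thesis by simp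
    qed
    ultimately show "\<exists>y. DERIV p s :> y \<and> y \<le> 0" by blast
  qed simp
  then show ?thesis by (simp add: p_def d_def)
qed

text \<open>
  Both sides of the next inequality are compared through the point reached from \<open>y\<close> by a gradient
  step for the function \<open>g\<close> with its tangent at \<open>x\<close> removed: convexity bounds the value there from
  below, smoothness from above.
\<close>

lemma convex_smooth_bregman_lower_bound:
  assumes g: "\<And>x. GDERIV g x :> grad g x" and lip: "lipschitz_grad g L" and L: "L > 0"
    and conv: "strong_convexity g \<mu>" and \<mu>: "\<mu> \<ge> 0"
  shows "g x + grad g x \<bullet> (y - x) + 1 / (2 * L) * (norm (grad g y - grad g x))\<^sup>2 \<le> g y"
proof -
  define d where "d = grad g y - grad g x"
  define z where "z = y - (1 / L) *\<^sub>R d"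
  have "g x + grad g x \<bullet> (z - x) \<le> g x + grad g x \<bullet> (z - x) + \<mu> / 2 * (norm (x - z))\<^sup>2"
    using \<mu> by simp
  also have "\<dots> \<le> g z"
    using conv unfolding strong_convexity_def by blast
  also have "g z \<le> g y + grad g y \<bullet> (z - y) + L / 2 * (norm (z - y))\<^sup>2"
    by (rule lipschitz_grad_descent[OF g lip])
  finally have "g x + grad g x \<bullet> (z - x) \<le> g y + grad g y \<bullet> (z - y) + L / 2 * (norm (z - y))\<^sup>2" .
  moreover have "grad g x \<bullet> (z - x) = grad g x \<bullet> (y - x) - (1 / L) * (grad g x \<bullet> d)"
    by (simp add: z_def algebra_simps)
  moreover have "grad g y \<bullet> (z - y) = - ((1 / L) * (grad g y \<bullet> d))"
    by (simp add: z_def)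
  moreover have "L / 2 * (norm (z - y))\<^sup>2 = (1 / L) * (norm d)\<^sup>2 / 2"
    using L by (simp add: z_def power2_eq_square)
  ultimately have ineq: "g x + (grad g x \<bullet> (y - x) - (1 / L) * (grad g x \<bullet> d))
      \<le> g y - (1 / L) * (grad g y \<bullet> d) + (1 / L) * (norm d)\<^sup>2 / 2"
    by simp
  have "grad g y \<bullet> d = grad g x \<bullet> d + (norm d)\<^sup>2"
    by (simp add: d_def power2_norm_eq_inner inner_diff_left)
  then have "(1 / L) * (grad g y \<bullet> d) = (1 / L) * (grad g x \<bullet> d) + (1 / L) * (norm d)\<^sup>2"
    by (simp only: distrib_left)
  with ineq have "g x + grad g x \<bullet> (y - x) + (1 / L) * (norm d)\<^sup>2 / 2 \<le> g y"
    by argo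
  moreover have "1 / (2 * L) * (norm (grad g y - grad g x))\<^sup>2 = (1 / L) * (norm d)\<^sup>2 / 2"
    unfolding d_def by simp
  ultimately show ?thesis by argo
qed

text \<open>
  This is the preceding bound added to itself with \<open>x\<close> and \<open>y\<close> exchanged.
\<close>

lemma convex_smooth_cocoercive:
  assumes g: "\<And>x. GDERIV g x :> grad g x" and lip: "lipschitz_grad g L" and L: "L > 0"
    and conv: "strong_convexity g \<mu>" and \<mu>: "\<mu> \<ge> 0"
  shows "(norm (grad g x - grad g y))\<^sup>2 \<le> L * ((grad g x - grad g y) \<bullet> (x - y))"
proof -
  define N where "N = (norm (grad g x - grad g y))\<^sup>2"
  have "g x + grad g x \<bullet> (y - x) + 1 / (2 * L) * N \<le> g y"
    using convex_smooth_bregman_lower_bound[OF assms, of x y] by (metis N_def norm_minus_commute)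
  moreover have "g y + grad g y \<bullet> (x - y) + 1 / (2 * L) * N \<le> g x"
    using convex_smooth_bregman_lower_bound[OF assms, of y x] by (simp only: N_def)
  moreover have "grad g x \<bullet> (y - x) + grad g y \<bullet> (x - y) = - ((grad g x - grad g y) \<bullet> (x - y))"
    by (simp add: inner_diff_left inner_diff_right)
  ultimately have "2 * (1 / (2 * L) * N) \<le> (grad g x - grad g y) \<bullet> (x - y)"
    by argo
  then have "N / L \<le> (grad g x - grad g y) \<bullet> (x - y)" by simp
  then show ?thesis
    using L unfolding N_def[symmetric] by (simp add: pos_divide_le_eq mult.commute)
qed

lemma strong_convexity_imp_strongly_monotone:
  assumes "strong_convexity g \<mu>"
  shows "\<mu> * (norm (x - y))\<^sup>2 \<le> (grad g x - grad g y) \<bullet> (x - y)"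
proof -
  have "g y + grad g y \<bullet> (x - y) + \<mu> / 2 * (norm (x - y))\<^sup>2 \<le> g x"
    and "g x + grad g x \<bullet> (y - x) + \<mu> / 2 * (norm (x - y))\<^sup>2 \<le> g y"
    using assms unfolding strong_convexity_def by (metis norm_minus_commute)+
  moreover have "(grad g x - grad g y) \<bullet> (x - y) = - (grad g x \<bullet> (y - x)) - grad g y \<bullet> (x - y)"
    by (simp add: inner_diff_left inner_diff_right)
  ultimately show ?thesis by argo
qed

text \<open>
  Otherwise a gradient step of length \<open>1 / L\<close> would decrease \<open>g\<close> strictly.
\<close>

lemma grad_at_minimizer:
  assumes g: "\<And>x. GDERIV g x :> grad g x" and lip: "lipschitz_grad g L" and L: "L > 0"
    and min: "is_arg_min g (\<lambda>_. True) x"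
  shows "grad g x = 0"
proof -
  let ?y = "x - (1 / L) *\<^sub>R grad g x"
  have "g x \<le> g ?y"
    using min by (simp add: is_arg_min_linorder)
  also have "\<dots> \<le> g x + grad g x \<bullet> (?y - x) + L / 2 * (norm (?y - x))\<^sup>2"
    by (rule lipschitz_grad_descent[OF g lip])
  also have "\<dots> = g x - 1 / (2 * L) * (norm (grad g x))\<^sup>2"
    using L by (simp add: power2_norm_eq_inner power2_eq_square field_simps flip: power2_norm_eq_inner)
  finally have "1 / (2 * L) * (norm (grad g x))\<^sup>2 \<le> 0" by simp
  then show ?thesis
    using L by (simp add: divide_le_0_iff)
qed

section \<open>Finite sums with a common smoothness and convexity constant\<close>

locale finite_sum_objective =
  fixes n :: nat and f :: "nat \<Rightarrow> 'a::euclidean_space \<Rightarrow> real" and \<mu> L :: real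
  assumes n_pos: "n \<ge> 1"
    and f_GDERIV: "\<And>i x. i \<in> {1..n} \<Longrightarrow> GDERIV (f i) x :> grad (f i) x"
    and f_conv: "\<And>i. i \<in> {1..n} \<Longrightarrow> strong_convexity (f i) \<mu>"
    and f_lip: "\<And>i. i \<in> {1..n} \<Longrightarrow> lipschitz_grad (f i) L"
    and \<mu>_pos: "\<mu> > 0" and L_pos: "L > 0"
begin

abbreviation "F \<equiv> avg_fun n f"

lemma F_GDERIV: "GDERIV F x :> (1 / real n) *\<^sub>R (\<Sum>i=1..n. grad (f i) x)"
proof -
  have "((\<lambda>w. (1 / real n) * (\<Sum>i=1..n. f i w)) has_derivative
      (\<lambda>h. (1 / real n) * (\<Sum>i=1..n. h \<bullet> grad (f i) x))) (at x)"
    using f_GDERIV unfolding gderiv_def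
    by (intro has_derivative_mult_right has_derivative_sum) auto
  then show ?thesis
    unfolding gderiv_def by (simp add: avg_fun_def[abs_def] inner_sum_right)
qed

lemma grad_F: "grad F x = (1 / real n) *\<^sub>R (\<Sum>i=1..n. grad (f i) x)"
  by (rule grad_eqI) (rule F_GDERIV)

lemma F_GDERIV_grad: "GDERIV F x :> grad F x"
  using F_GDERIV grad_F by simp

lemma F_lip: "lipschitz_grad F L"
  unfolding lipschitz_grad_def
proof (intro allI)
  fix w z
  have "norm (grad F w - grad F z) = (1 / real n) * norm (\<Sum>i=1..n. grad (f i) w - grad (f i) z)"
    by (simp add: grad_F sum_subtractf scaleR_diff_right[symmetric])
  also have "\<dots> \<le> (1 / real n) * (\<Sum>i=1..n. L * norm (w - z))"
    using f_lip unfolding lipschitz_grad_def by (intro mult_left_mono sum_norm_le) auto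
  also have "\<dots> = L * norm (w - z)" using n_pos by simp
  finally show "norm (grad F w - grad F z) \<le> L * norm (w - z)" .
qed

lemma F_conv: "strong_convexity F \<mu>"
  unfolding strong_convexity_def
proof (intro allI)
  fix w z
  have "F z + grad F z \<bullet> (w - z) + \<mu> / 2 * (norm (z - w))\<^sup>2
      = (1 / real n) * (\<Sum>i=1..n. f i z + grad (f i) z \<bullet> (w - z) + \<mu> / 2 * (norm (z - w))\<^sup>2)"
    using n_pos by (simp add: grad_F avg_fun_def sum.distrib inner_sum_left distrib_left)
  also have "\<dots> \<le> (1 / real n) * (\<Sum>i=1..n. f i w)"
    using f_conv unfolding strong_convexity_def by (intro mult_left_mono sum_mono) auto
  finally show "F w \<ge> F z + grad F z \<bullet> (w - z) + \<mu> / 2 * (norm (z - w))\<^sup>2"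
    by (simp add: avg_fun_def)
qed

lemma F_monotone: "\<mu> * (norm (x - y))\<^sup>2 \<le> (grad F x - grad F y) \<bullet> (x - y)"
  by (rule strong_convexity_imp_strongly_monotone[OF F_conv])

lemma F_cocoercive:
  "(norm (grad F x - grad F y))\<^sup>2 \<le> L * ((grad F x - grad F y) \<bullet> (x - y))"
  using convex_smooth_cocoercive[OF F_GDERIV_grad F_lip L_pos F_conv] \<mu>_pos by simp

lemma avg_component_cocoercive:
  "(1 / real n) * (\<Sum>i=1..n. (norm (grad (f i) x - grad (f i) y))\<^sup>2)
    \<le> L * ((grad F x - grad F y) \<bullet> (x - y))"
proof -
  have "(1 / real n) * (\<Sum>i=1..n. (norm (grad (f i) x - grad (f i) y))\<^sup>2)
      \<le> (1 / real n) * (\<Sum>i=1..n. L * ((grad (f i) x - grad (f i) y) \<bullet> (x - y)))"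
    using convex_smooth_cocoercive[OF f_GDERIV f_lip L_pos f_conv] \<mu>_pos
    by (intro mult_left_mono sum_mono) auto
  also have "\<dots> = L * ((grad F x - grad F y) \<bullet> (x - y))"
    by (simp add: grad_F sum_distrib_left[symmetric] inner_sum_left[symmetric] sum_subtractf
        scaleR_diff_right[symmetric])
  finally show ?thesis .
qed

lemma avg_component_lipschitz:
  "(1 / real n) * (\<Sum>i=1..n. (norm (grad (f i) x - grad (f i) y))\<^sup>2) \<le> L\<^sup>2 * (norm (x - y))\<^sup>2"
proof -
  have "(norm (grad (f i) x - grad (f i) y))\<^sup>2 \<le> L\<^sup>2 * (norm (x - y))\<^sup>2" if "i \<in> {1..n}" for i
    using f_lip[OF that] unfolding lipschitz_grad_def power_mult_distrib[symmetric]
    by (intro power_mono) auto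
  then have "(1 / real n) * (\<Sum>i=1..n. (norm (grad (f i) x - grad (f i) y))\<^sup>2)
      \<le> (1 / real n) * (\<Sum>i=1..n. L\<^sup>2 * (norm (x - y))\<^sup>2)"
    by (intro mult_left_mono sum_mono) auto
  then show ?thesis using n_pos by simp
qed

text \<open>
  Inserting the minimizer \<open>z\<close> between \<open>w\<close> and the snapshot \<open>c\<close> splits the gradient differences: the
  part at \<open>w\<close> is absorbed by the descent term, and only the part at \<open>c\<close> survives as an error.
\<close>

lemma avg_component_variation:
  assumes z: "grad F z = 0"
  shows "(1 / real n) * (\<Sum>i=1..n. (norm (grad (f i) w - grad (f i) c))\<^sup>2)
    \<le> 2 * L * (grad F w \<bullet> (w - z)) + 2 * L\<^sup>2 * (norm (c - z))\<^sup>2"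
proof -
  let ?g = "\<lambda>i. grad (f i)"
  have two: "(norm (a - b))\<^sup>2 \<le> 2 * (norm a)\<^sup>2 + 2 * (norm b)\<^sup>2" for a b :: 'a
    using zero_le_power2[of "norm (a + b)"]
    by (simp add: power2_norm_eq_inner inner_diff_left inner_diff_right inner_add_left
        inner_add_right inner_commute)
  have "(norm (?g i w - ?g i c))\<^sup>2 \<le> 2 * (norm (?g i w - ?g i z))\<^sup>2 + 2 * (norm (?g i c - ?g i z))\<^sup>2" for i
    using two[of "?g i w - ?g i z" "?g i c - ?g i z"] by simp
  then have "(1 / real n) * (\<Sum>i=1..n. (norm (?g i w - ?g i c))\<^sup>2)
      \<le> (1 / real n) * (\<Sum>i=1..n. 2 * (norm (?g i w - ?g i z))\<^sup>2 + 2 * (norm (?g i c - ?g i z))\<^sup>2)"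
    by (intro mult_left_mono sum_mono) auto
  also have "\<dots> = 2 * ((1 / real n) * (\<Sum>i=1..n. (norm (?g i w - ?g i z))\<^sup>2))
      + 2 * ((1 / real n) * (\<Sum>i=1..n. (norm (?g i c - ?g i z))\<^sup>2))"
    by (simp add: sum.distrib sum_distrib_left[symmetric] distrib_left)
  finally show ?thesis
    using avg_component_cocoercive[of w z] avg_component_lipschitz[of c z] z by simp
qed

text \<open>
  The contraction factor asks only for \<open>2 \<eta> (1 - \<eta> L (2 \<alpha> + 1))\<close> as coefficient of the inner product
  between \<open>grad F w\<close> and \<open>w - z\<close>, while cocoercivity leaves \<open>2 \<eta> - \<eta>\<^sup>2 L (2 \<alpha> + 1)\<close>.  Factoring out
  \<open>\<eta>\<close> before bounding it by \<open>\<eta>\<^sub>0\<close> from below and \<open>\<eta>\<^sub>1\<close> from above keeps the negative term intact.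
\<close>

lemma descent_with_variance_contracts:
  fixes w c z :: 'a
  assumes z: "grad F z = 0" and \<alpha>: "\<alpha> > 0"
    and \<eta>: "\<eta>\<^sub>0 \<le> \<eta>" "\<eta> \<le> \<eta>\<^sub>1" "\<eta>\<^sub>0 > 0" and q: "1 - \<eta>\<^sub>1 * L * (2 * \<alpha> + 1) > 0"
  shows "(norm (w - \<eta> *\<^sub>R grad F w - z))\<^sup>2
      + \<alpha> * \<eta>\<^sup>2 * ((1 / real n) * (\<Sum>i=1..n. (norm (grad (f i) w - grad (f i) c))\<^sup>2))
    \<le> (1 - 2 * \<eta>\<^sub>0 * \<mu> * (1 - \<eta>\<^sub>1 * L * (2 * \<alpha> + 1))) * (norm (w - z))\<^sup>2
      + 2 * \<alpha> * \<eta>\<^sub>1\<^sup>2 * L\<^sup>2 * (norm (c - z))\<^sup>2"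
proof -
  define a where "a = (norm (w - z))\<^sup>2"
  define e where "e = (norm (c - z))\<^sup>2"
  define S where "S = grad F w \<bullet> (w - z)"
  define V where "V = (1 / real n) * (\<Sum>i=1..n. (norm (grad (f i) w - grad (f i) c))\<^sup>2)"
  define q where "q = 1 - \<eta>\<^sub>1 * L * (2 * \<alpha> + 1)"
  have nonneg: "a \<ge> 0" "e \<ge> 0" "q > 0"
    using q by (simp_all only: a_def e_def q_def zero_le_power2)
  have G: "(norm (grad F w))\<^sup>2 \<le> L * S"
    using F_cocoercive[of w z] z by (simp add: S_def)
  have Sa: "\<mu> * a \<le> S"
    using F_monotone[of w z] z by (simp add: S_def a_def)
  have "(norm (w - \<eta> *\<^sub>R grad F w - z))\<^sup>2 = a - 2 * \<eta> * S + \<eta>\<^sup>2 * (norm (grad F w))\<^sup>2"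
    unfolding a_def S_def power2_norm_eq_inner
    by (simp add: algebra_simps inner_commute power2_eq_square)
  moreover have "\<eta>\<^sup>2 * (norm (grad F w))\<^sup>2 \<le> \<eta>\<^sup>2 * (L * S)"
    using G by (rule mult_left_mono) simp
  moreover have "\<alpha> * \<eta>\<^sup>2 * V \<le> \<alpha> * \<eta>\<^sup>2 * (2 * L * S + 2 * L\<^sup>2 * e)"
    using avg_component_variation[OF z, of w c] \<alpha> unfolding V_def S_def e_def
    by (intro mult_left_mono) auto
  moreover have "\<alpha> * \<eta>\<^sup>2 * (2 * L * S + 2 * L\<^sup>2 * e)
      = \<eta>\<^sup>2 * (2 * \<alpha> * L * S) + 2 * \<alpha> * \<eta>\<^sup>2 * L\<^sup>2 * e"
    by (simp add: algebra_simps)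
  moreover have "2 * \<alpha> * \<eta>\<^sup>2 * L\<^sup>2 * e \<le> 2 * \<alpha> * \<eta>\<^sub>1\<^sup>2 * L\<^sup>2 * e"
    using \<alpha> \<eta> nonneg by (intro mult_right_mono mult_left_mono power_mono) auto
  moreover have "2 * \<eta>\<^sub>0 * \<mu> * q * a \<le> 2 * \<eta> * S - \<eta>\<^sup>2 * (L * S) - \<eta>\<^sup>2 * (2 * \<alpha> * L * S)"
  proof -
    have "\<eta> * (L * (2 * \<alpha> + 1)) \<le> \<eta>\<^sub>1 * (L * (2 * \<alpha> + 1))"
      using \<eta> \<alpha> L_pos by (intro mult_right_mono) auto
    moreover have "\<eta>\<^sub>1 * (L * (2 * \<alpha> + 1)) \<ge> 0"
      using \<eta> \<alpha> L_pos by auto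
    ultimately have le: "2 * q \<le> 2 - \<eta> * (L * (2 * \<alpha> + 1))"
      using nonneg by (simp add: q_def mult.assoc)
    have "\<eta>\<^sub>0 * (\<mu> * a) \<le> \<eta> * S"
      using \<eta> Sa nonneg \<mu>_pos by (intro mult_mono) auto
    moreover have \<eta>S: "0 \<le> \<eta> * S"
      using Sa \<eta> \<mu>_pos nonneg by (smt (verit) mult_nonneg_nonneg)
    ultimately have "(\<eta>\<^sub>0 * (\<mu> * a)) * (2 * q) \<le> (\<eta> * S) * (2 - \<eta> * (L * (2 * \<alpha> + 1)))"
      using le nonneg \<eta>S by (intro mult_mono[of "\<eta>\<^sub>0 * (\<mu> * a)" "\<eta> * S"]) simp_all
    then show ?thesis by (simp add: algebra_simps power2_eq_square)
  qed
  ultimately show ?thesis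
    unfolding a_def[symmetric] e_def[symmetric] V_def[symmetric] q_def[symmetric]
    by (simp add: algebra_simps)
qed

end

section \<open>One inner iteration\<close>

text \<open>
  The mixed terms average to zero, and the variance of \<open>X\<close> is at most its second moment.
\<close>

lemma avg_norm_sq_centered:
  fixes X :: "nat \<Rightarrow> 'a::real_inner"
  assumes n: "n \<ge> 1"
  defines "Xbar \<equiv> (1 / real n) *\<^sub>R (\<Sum>i=1..n. X i)"
  shows "(1 / real n) * (\<Sum>i=1..n. (norm (y - \<eta> *\<^sub>R (X i - Xbar)))\<^sup>2)
    \<le> (norm y)\<^sup>2 + \<eta>\<^sup>2 * ((1 / real n) * (\<Sum>i=1..n. (norm (X i))\<^sup>2))"
proof -
  have sumX: "(\<Sum>i=1..n. X i) = real n *\<^sub>R Xbar"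
    using n by (simp add: Xbar_def)
  define K where "K = (norm y)\<^sup>2 + 2 * \<eta> * (y \<bullet> Xbar) + \<eta>\<^sup>2 * (norm Xbar)\<^sup>2"
  define v where "v = (2 * \<eta>) *\<^sub>R y + (2 * \<eta>\<^sup>2) *\<^sub>R Xbar"
  have "(norm (y - \<eta> *\<^sub>R (X i - Xbar)))\<^sup>2 = K + \<eta>\<^sup>2 * (norm (X i))\<^sup>2 - v \<bullet> X i" for i
    unfolding power2_norm_eq_inner K_def v_def
    by (simp add: algebra_simps inner_commute power2_eq_square)
  then have "(\<Sum>i=1..n. (norm (y - \<eta> *\<^sub>R (X i - Xbar)))\<^sup>2)
      = real n * K + \<eta>\<^sup>2 * (\<Sum>i=1..n. (norm (X i))\<^sup>2) - v \<bullet> (real n *\<^sub>R Xbar)"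
    by (simp add: sum_subtractf sum.distrib sum_distrib_left inner_sum_right flip: sumX)
  also have "\<dots> = real n * (norm y)\<^sup>2 + \<eta>\<^sup>2 * (\<Sum>i=1..n. (norm (X i))\<^sup>2) - real n * (\<eta>\<^sup>2 * (norm Xbar)\<^sup>2)"
    unfolding power2_norm_eq_inner K_def v_def
    by (simp add: algebra_simps inner_commute power2_eq_square)
  also have "\<dots> \<le> real n * (norm y)\<^sup>2 + \<eta>\<^sup>2 * (\<Sum>i=1..n. (norm (X i))\<^sup>2)"
    by simp
  finally show ?thesis using n by (simp add: field_simps)
qed

text \<open>
  The error of the Barzilai-Borwein linear model for the gradient difference of component \<open>i\<close>.
\<close>

definition svrg_residual where
  "svrg_residual f p c i w = grad (f i) w - grad (f i) c - bb_matrix (f i) p c *v (w - c)"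

lemma matrix_vector_mult_sum_left:
  "(\<Sum>i\<in>S. A i) *v (x :: real ^ 'd) = (\<Sum>i\<in>S. (A i :: real ^ 'd ^ 'e) *v x)"
  by (induction S rule: infinite_finite_induct) (simp_all add: matrix_vector_mult_add_rdistrib)

locale bb_objective = finite_sum_objective n f \<mu> L
  for n :: nat and f :: "nat \<Rightarrow> real ^ 'd \<Rightarrow> real" and \<mu> L :: real
begin

text \<open>
  The direction is the full gradient plus the centred residual, so it is unbiased and its variance
  is at most the second moment of the residual.
\<close>

lemma svrg_direction_eq:
  "svrg_direction n f p c i w = grad F w
    + (svrg_residual f p c i w - (1 / real n) *\<^sub>R (\<Sum>j=1..n. svrg_residual f p c j w))"
proof -
  have "(1 / real n) *\<^sub>R (\<Sum>j=1..n. svrg_residual f p c j w)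
      = grad F w - grad F c - bb_matrix_avg n f p c *v (w - c)"
    unfolding svrg_residual_def grad_F bb_matrix_avg_def
    by (simp add: sum_subtractf scaleR_diff_right matrix_vector_mult_sum_left
        scaleR_matrix_vector_assoc[symmetric])
  then show ?thesis
    by (simp add: svrg_direction_def svrg_residual_def matrix_vector_mult_diff_rdistrib)
qed

lemma avg_svrg_step:
  "(1 / real n) * (\<Sum>i=1..n. (norm (w - \<eta> *\<^sub>R svrg_direction n f p c i w - z))\<^sup>2)
    \<le> (norm (w - \<eta> *\<^sub>R grad F w - z))\<^sup>2
      + \<eta>\<^sup>2 * ((1 / real n) * (\<Sum>i=1..n. (norm (svrg_residual f p c i w))\<^sup>2))"
proof -
  have "w - \<eta> *\<^sub>R svrg_direction n f p c i w - z = (w - \<eta> *\<^sub>R grad F w - z)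
      - \<eta> *\<^sub>R (svrg_residual f p c i w - (1 / real n) *\<^sub>R (\<Sum>j=1..n. svrg_residual f p c j w))" for i
    unfolding svrg_direction_eq[of p c i w] by (simp only: scaleR_add_right) simp
  then show ?thesis
    using avg_norm_sq_centered[OF n_pos, where X = "\<lambda>i. svrg_residual f p c i w"]
    by (simp only:)
qed

text \<open>
  The quotient in the step size is an inverse Rayleigh quotient of the averaged Hessian between the
  two snapshots: strong monotonicity and the Lipschitz bound confine it to \<open>[1 / L, 1 / \<mu>]\<close>.  For
  equal snapshots the formula degenerates to a step of length zero.
\<close>

lemma bb_step_bounds:
  assumes pc: "c \<noteq> p" and m1: "m\<^sub>1 > 0" and x: "x \<in> {l<..<h}" and l: "0 < l"
  shows "l / (m\<^sub>1 * L) \<le> bb_step n f m\<^sub>1 x p c" "bb_step n f m\<^sub>1 x p c \<le> h / (m\<^sub>1 * \<mu>)"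
proof -
  define N where "N = (norm (c - p))\<^sup>2"
  define D where "D = (c - p) \<bullet> (grad F c - grad F p)"
  have N: "N > 0" using pc by (simp add: N_def)
  have lower: "\<mu> * N \<le> D"
    using F_monotone[of c p] by (simp add: N_def D_def inner_commute)
  then have D: "D > 0" using N \<mu>_pos by (smt (verit) mult_pos_pos)
  have "D \<le> norm (c - p) * norm (grad F c - grad F p)"
    unfolding D_def by (rule norm_cauchy_schwarz)
  also have "\<dots> \<le> norm (c - p) * (L * norm (c - p))"
    using F_lip unfolding lipschitz_grad_def by (intro mult_left_mono) auto
  finally have upper: "D \<le> L * N"
    by (simp add: N_def power2_eq_square mult_ac)
  have "1 / L \<le> N / D" "N / D \<le> 1 / \<mu>"
    using lower upper D L_pos \<mu>_pos by (simp_all add: field_simps)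
  then have "l / m\<^sub>1 * (1 / L) \<le> x / m\<^sub>1 * (N / D)" "x / m\<^sub>1 * (N / D) \<le> h / m\<^sub>1 * (1 / \<mu>)"
    using x l m1 L_pos N D by (intro mult_mono divide_right_mono; force)+
  then show "l / (m\<^sub>1 * L) \<le> bb_step n f m\<^sub>1 x p c" "bb_step n f m\<^sub>1 x p c \<le> h / (m\<^sub>1 * \<mu>)"
    by (simp_all add: bb_step_def N_def D_def)
qed

end

section \<open>Dependence of the iterates on the sampled indices\<close>

lemma svrg_inner_cong:
  assumes "\<And>s. s \<in> {1..t} \<Longrightarrow> \<iota> s = \<iota>' s"
  shows "svrg_inner n f m\<^sub>1 \<xi> p c \<iota> t = svrg_inner n f m\<^sub>1 \<xi> p c \<iota>' t"
  using assms by (induction t) simp_all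

lemma svrg_state_cong:
  assumes "\<And>j s. j \<in> {1..k} \<Longrightarrow> s \<in> {1..m} \<Longrightarrow> \<iota> j s = \<iota>' j s"
  shows "svrg_state n f m m\<^sub>1 \<xi> wm1 w0 \<iota> k = svrg_state n f m m\<^sub>1 \<xi> wm1 w0 \<iota>' k"
  using assms
proof (induction k)
  case (Suc k)
  have "svrg_inner n f m\<^sub>1 (\<xi> (Suc k)) p c (\<iota> (Suc k)) m
      = svrg_inner n f m\<^sub>1 (\<xi> (Suc k)) p c (\<iota>' (Suc k)) m" for p c
    by (intro svrg_inner_cong Suc.prems) auto
  then show ?case
    using Suc by simp
qed simp

lemma inner_iterate_0: "inner_iterate n f m m\<^sub>1 \<xi> wm1 w0 \<iota> k 0 = snapshot n f m m\<^sub>1 \<xi> wm1 w0 \<iota> (k - 1)"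
  by (simp add: inner_iterate_def)

lemma inner_iterate_Suc:
  "inner_iterate n f m m\<^sub>1 \<xi> wm1 w0 \<iota> k (Suc t) =
     inner_iterate n f m m\<^sub>1 \<xi> wm1 w0 \<iota> k t
       - bb_step n f m\<^sub>1 (\<xi> k (Suc t)) (snapshot_prev n f m m\<^sub>1 \<xi> wm1 w0 \<iota> (k - 1))
           (snapshot n f m m\<^sub>1 \<xi> wm1 w0 \<iota> (k - 1))
         *\<^sub>R svrg_direction n f (snapshot_prev n f m m\<^sub>1 \<xi> wm1 w0 \<iota> (k - 1))
           (snapshot n f m m\<^sub>1 \<xi> wm1 w0 \<iota> (k - 1)) (\<iota> k (Suc t))
           (inner_iterate n f m m\<^sub>1 \<xi> wm1 w0 \<iota> k t)"
  by (simp add: inner_iterate_def)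

lemma inner_iterate_last:
  assumes "k \<ge> 1"
  shows "inner_iterate n f m m\<^sub>1 \<xi> wm1 w0 \<iota> k m = snapshot n f m m\<^sub>1 \<xi> wm1 w0 \<iota> k"
  using assms
  by (cases k) (simp_all add: inner_iterate_def snapshot_def snapshot_prev_def split: prod.split)

lemma
  assumes "k \<ge> 1" and "\<And>j s. (j, s) \<in> past_indices m k t \<Longrightarrow> \<iota> j s = \<iota>' j s"
  shows snapshot_cong_past:
      "snapshot n f m m\<^sub>1 \<xi> wm1 w0 \<iota> (k - 1) = snapshot n f m m\<^sub>1 \<xi> wm1 w0 \<iota>' (k - 1)"
    and snapshot_prev_cong_past:
      "snapshot_prev n f m m\<^sub>1 \<xi> wm1 w0 \<iota> (k - 1) = snapshot_prev n f m m\<^sub>1 \<xi> wm1 w0 \<iota>' (k - 1)"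
proof -
  have "svrg_state n f m m\<^sub>1 \<xi> wm1 w0 \<iota> (k - 1) = svrg_state n f m m\<^sub>1 \<xi> wm1 w0 \<iota>' (k - 1)"
    using assms(1) by (intro svrg_state_cong assms(2)) (auto simp: past_indices_def)
  then show "snapshot n f m m\<^sub>1 \<xi> wm1 w0 \<iota> (k - 1) = snapshot n f m m\<^sub>1 \<xi> wm1 w0 \<iota>' (k - 1)"
    and "snapshot_prev n f m m\<^sub>1 \<xi> wm1 w0 \<iota> (k - 1) = snapshot_prev n f m m\<^sub>1 \<xi> wm1 w0 \<iota>' (k - 1)"
    by (simp_all add: snapshot_def snapshot_prev_def)
qed

text \<open>
  The iterate from which step \<open>t\<close> of epoch \<open>k\<close> starts is a function of the indices that
  generate the past alone, which is what makes it measurable with respect to the past and independent of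
  the index drawn next.
\<close>

lemma inner_iterate_cong_past:
  assumes k: "k \<ge> 1" and t: "t \<in> {1..m}"
    and eq: "\<And>j s. (j, s) \<in> past_indices m k t \<Longrightarrow> \<iota> j s = \<iota>' j s"
  shows "inner_iterate n f m m\<^sub>1 \<xi> wm1 w0 \<iota> k (t - 1) = inner_iterate n f m m\<^sub>1 \<xi> wm1 w0 \<iota>' k (t - 1)"
proof -
  have "svrg_inner n f m\<^sub>1 (\<xi> k) p c (\<iota> k) (t - 1) = svrg_inner n f m\<^sub>1 (\<xi> k) p c (\<iota>' k) (t - 1)" for p c
    using k t by (intro svrg_inner_cong eq) (auto simp: past_indices_def)
  moreover have "snapshot n f m m\<^sub>1 \<xi> wm1 w0 \<iota> (k - 1) = snapshot n f m m\<^sub>1 \<xi> wm1 w0 \<iota>' (k - 1)"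
    by (rule snapshot_cong_past[OF k eq])
  moreover have "snapshot_prev n f m m\<^sub>1 \<xi> wm1 w0 \<iota> (k - 1) = snapshot_prev n f m m\<^sub>1 \<xi> wm1 w0 \<iota>' (k - 1)"
    by (rule snapshot_prev_cong_past[OF k eq])
  ultimately show ?thesis
    by (simp only: inner_iterate_def)
qed

section \<open>Averaging over a fresh index\<close>

lemma finite_past_indices: "finite (past_indices m k t)"
  by (rule finite_subset[of _ "{1..k} \<times> {1..m}"]) (auto simp: past_indices_def)

lemma borel_measurable_PiM_count_space:
  fixes \<phi> :: "('i \<Rightarrow> 'a::countable) \<Rightarrow> 'b::topological_space"
  assumes "finite P"
  shows "\<phi> \<in> borel_measurable (PiM P (\<lambda>_. count_space UNIV))"
  using assms by (subst count_space_PiM_finite) auto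

locale uniform_index_sampling = prob_space M
  for M :: "'w measure" and n m :: nat and I :: "nat \<Rightarrow> nat \<Rightarrow> 'w \<Rightarrow> nat" +
  assumes n_ge_1: "n \<ge> 1" and uniform_iid: "uniform_iid_indices M n m I"
begin

definition past :: "nat \<Rightarrow> nat \<Rightarrow> 'w \<Rightarrow> nat \<times> nat \<Rightarrow> nat" where
  "past k t \<omega> = (\<lambda>(j, s)\<in>past_indices m k t. I j s \<omega>)"

lemma indep_indices: "indep_vars (\<lambda>_. count_space UNIV) (\<lambda>(k, t). I k t) ({1..} \<times> {1..m})"
  using uniform_iid unfolding uniform_iid_indices_def by blast

lemma past_indices_subset: "past_indices m k t \<subseteq> {1..} \<times> {1..m}"
  by (auto simp: past_indices_def)

lemma index_measurable:
  assumes "k \<ge> 1" "t \<in> {1..m}"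
  shows "I k t \<in> M \<rightarrow>\<^sub>M count_space UNIV"
  using indep_indices assms unfolding indep_vars_def by fastforce

lemma past_measurable: "past k t \<in> M \<rightarrow>\<^sub>M PiM (past_indices m k t) (\<lambda>_. count_space UNIV)"
  unfolding past_def[abs_def] case_prod_beta'
  using index_measurable by (intro measurable_restrict) (auto simp: past_indices_def)

lemma subalgebra_past: "subalgebra M (past_algebra M m I k t)"
  using measurable_sets[OF past_measurable[of k t]]
  unfolding subalgebra_def past_algebra_def past_def[abs_def]
  by (auto simp: sets_vimage_algebra intro!: sets.sigma_sets_subset)

lemma past_function_measurable_past:
  fixes \<phi> :: "(nat \<times> nat \<Rightarrow> nat) \<Rightarrow> real"
  shows "(\<lambda>\<omega>. \<phi> (past k t \<omega>)) \<in> borel_measurable (past_algebra M m I k t)"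
proof -
  have "past k t \<in> past_algebra M m I k t \<rightarrow>\<^sub>M PiM (past_indices m k t) (\<lambda>_. count_space UNIV)"
    using measurable_vimage_algebra1[of "past k t" "space M"
        "PiM (past_indices m k t) (\<lambda>_. count_space UNIV)"] measurable_space[OF past_measurable[of k t]]
    unfolding past_algebra_def past_def[abs_def] by blast
  from measurable_comp[OF this borel_measurable_PiM_count_space[OF finite_past_indices, of \<phi>]]
  show ?thesis by (simp add: o_def)
qed

lemma past_function_measurable:
  fixes \<phi> :: "(nat \<times> nat \<Rightarrow> nat) \<Rightarrow> real"
  shows "(\<lambda>\<omega>. \<phi> (past k t \<omega>)) \<in> borel_measurable M"
  using measurable_from_subalg[OF subalgebra_past past_function_measurable_past] .

lemma past_index_function_measurable:
  fixes h :: "(nat \<times> nat \<Rightarrow> nat) \<Rightarrow> nat \<Rightarrow> real"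
  assumes "k \<ge> 1" "t \<in> {1..m}"
  shows "(\<lambda>\<omega>. h (past k t \<omega>) (I k t \<omega>)) \<in> borel_measurable M"
  by (rule measurable_compose_countable[OF past_function_measurable index_measurable[OF assms]])

lemma AE_index_in_range:
  assumes "k \<ge> 1" "t \<in> {1..m}"
  shows "AE \<omega> in M. I k t \<omega> \<in> {1..n}"
proof -
  have "distr M (count_space UNIV) (I k t) = measure_pmf (pmf_of_set {1..n})"
    using uniform_iid assms unfolding uniform_iid_indices_def by blast
  moreover have "AE i in measure_pmf (pmf_of_set {1..n}). i \<in> {1..n}"
    using n_ge_1 by (subst AE_measure_pmf_iff) (auto simp: set_pmf_of_set)
  ultimately have "AE i in distr M (count_space UNIV) (I k t). i \<in> {1..n}"
    by (simp only:)
  then show ?thesis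
    by (subst (asm) AE_distr_iff[OF index_measurable[OF assms]]) auto
qed

lemma expectation_index_indicator:
  assumes "k \<ge> 1" "t \<in> {1..m}" and j: "j \<in> {1..n}"
  shows "expectation (\<lambda>\<omega>. indicat_real {j} (I k t \<omega>)) = 1 / real n"
proof -
  have d: "distr M (count_space UNIV) (I k t) = measure_pmf (pmf_of_set {1..n})"
    using uniform_iid assms unfolding uniform_iid_indices_def by blast
  have "expectation (\<lambda>\<omega>. indicat_real {j} (I k t \<omega>))
      = (\<integral>i. indicat_real {j} i \<partial>distr M (count_space UNIV) (I k t))"
    by (rule integral_distr[symmetric, OF index_measurable[OF assms(1,2)]]) simp
  also have "\<dots> = 1 / real n"
    using j n_ge_1 by (simp add: d measure_pmf_single)
  finally show ?thesis .
qed

lemma AE_past_in_range: "AE \<omega> in M. past k t \<omega> \<in> PiE (past_indices m k t) (\<lambda>_. {1..n})"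
proof -
  have "AE \<omega> in M. \<forall>x\<in>past_indices m k t. I (fst x) (snd x) \<omega> \<in> {1..n}"
    using past_indices_subset AE_index_in_range
    by (intro AE_finite_allI[OF finite_past_indices]) (auto simp: past_indices_def)
  then show ?thesis
    by eventually_elim (auto simp: past_def)
qed

text \<open>
  Only finitely many index values occur with positive probability, so every quantity determined by
  finitely many draws is essentially bounded, whatever functions produce it.  This makes every
  expectation below one of an integrable function.
\<close>

lemma integrable_past_index_function:
  fixes h :: "(nat \<times> nat \<Rightarrow> nat) \<Rightarrow> nat \<Rightarrow> real"
  assumes "k \<ge> 1" "t \<in> {1..m}"
  shows "integrable M (\<lambda>\<omega>. h (past k t \<omega>) (I k t \<omega>))"
proof (rule integrable_const_bound)
  let ?R = "PiE (past_indices m k t) (\<lambda>_. {1..n}) \<times> {1..n}"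
  have fin: "finite ?R"
    using finite_past_indices by (intro finite_cartesian_product finite_PiE) auto
  show "AE \<omega> in M. norm (h (past k t \<omega>) (I k t \<omega>)) \<le> Max ((\<lambda>(r, i). norm (h r i)) ` ?R)"
    using AE_past_in_range[of k t] AE_index_in_range[OF assms]
  proof eventually_elim
    case (elim \<omega>)
    then have "(past k t \<omega>, I k t \<omega>) \<in> ?R" by blast
    then have "(\<lambda>(r, i). norm (h r i)) (past k t \<omega>, I k t \<omega>) \<in> (\<lambda>(r, i). norm (h r i)) ` ?R"
      by (rule imageI)
    then show ?case
      using fin by (intro Max_ge) auto
  qed
qed (rule past_index_function_measurable[OF assms])

lemma integrable_past_function:
  fixes \<phi> :: "(nat \<times> nat \<Rightarrow> nat) \<Rightarrow> real"
  assumes "k \<ge> 1" "t \<in> {1..m}"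
  shows "integrable M (\<lambda>\<omega>. \<phi> (past k t \<omega>))"
  using integrable_past_index_function[OF assms, of "\<lambda>r _. \<phi> r"] .

lemma indep_past_index:
  fixes \<phi> :: "(nat \<times> nat \<Rightarrow> nat) \<Rightarrow> real" and \<psi> :: "nat \<Rightarrow> real"
  assumes kt: "k \<ge> 1" "t \<in> {1..m}"
  shows "indep_var borel (\<lambda>\<omega>. \<phi> (past k t \<omega>)) borel (\<lambda>\<omega>. \<psi> (I k t \<omega>))"
proof -
  let ?X = "\<lambda>(k, t). I k t" and ?P = "past_indices m k t"
  have "indep_var (PiM ?P (\<lambda>_. count_space UNIV)) (\<lambda>\<omega>. restrict (\<lambda>i. ?X i \<omega>) ?P)
      (PiM {(k, t)} (\<lambda>_. count_space UNIV)) (\<lambda>\<omega>. restrict (\<lambda>i. ?X i \<omega>) {(k, t)})"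
    using kt past_indices_subset
    by (intro indep_var_restrict[OF indep_indices]) (auto simp: past_indices_def)
  from indep_var_compose[OF this borel_measurable_PiM_count_space[OF finite_past_indices, of \<phi>]
      borel_measurable_PiM_count_space[of "{(k, t)}" "\<lambda>r. \<psi> (r (k, t))"]]
  show ?thesis
    by (simp add: o_def past_def case_prod_beta')
qed

text \<open>
  The index of step \<open>t\<close> is independent of the past, so in a full expectation it may be replaced by
  its average.
\<close>

lemma expectation_fresh_index:
  fixes h :: "(nat \<times> nat \<Rightarrow> nat) \<Rightarrow> nat \<Rightarrow> real"
  assumes kt: "k \<ge> 1" "t \<in> {1..m}"
  shows "expectation (\<lambda>\<omega>. h (past k t \<omega>) (I k t \<omega>))
    = expectation (\<lambda>\<omega>. (1 / real n) * (\<Sum>j=1..n. h (past k t \<omega>) j))"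
proof -
  let ?r = "past k t" and ?i = "I k t"
  have int: "integrable M (\<lambda>\<omega>. h (?r \<omega>) j * indicat_real {j} (?i \<omega>))" for j
    using integrable_past_index_function[OF kt, of "\<lambda>r i. h r j * indicat_real {j} i"] .
  have "AE \<omega> in M. h (?r \<omega>) (?i \<omega>) = (\<Sum>j=1..n. h (?r \<omega>) j * indicat_real {j} (?i \<omega>))"
    using AE_index_in_range[OF kt]
  proof eventually_elim
    case (elim \<omega>)
    then show ?case
      by (simp add: indicator_def of_bool_def if_distrib[of "\<lambda>x. _ * x"] cong: if_cong)
  qed
  then have "expectation (\<lambda>\<omega>. h (?r \<omega>) (?i \<omega>))
      = expectation (\<lambda>\<omega>. \<Sum>j=1..n. h (?r \<omega>) j * indicat_real {j} (?i \<omega>))"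
    by (intro integral_cong_AE past_index_function_measurable[OF kt] borel_measurable_sum
        borel_measurable_integrable[OF int])
  also have "\<dots> = (\<Sum>j=1..n. expectation (\<lambda>\<omega>. h (?r \<omega>) j * indicat_real {j} (?i \<omega>)))"
    by (intro Bochner_Integration.integral_sum int)
  also have "\<dots> = (\<Sum>j=1..n. expectation (\<lambda>\<omega>. h (?r \<omega>) j) * (1 / real n))"
  proof (rule sum.cong[OF refl])
    fix j assume j: "j \<in> {1..n}"
    have "expectation (\<lambda>\<omega>. h (?r \<omega>) j * indicat_real {j} (?i \<omega>))
        = expectation (\<lambda>\<omega>. h (?r \<omega>) j) * expectation (\<lambda>\<omega>. indicat_real {j} (?i \<omega>))"
      using integrable_past_function[OF kt] integrable_past_index_function[OF kt, of "\<lambda>_. indicat_real {j}"]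
      by (intro indep_var_lebesgue_integral indep_past_index[OF kt, of "\<lambda>r. h r j" "indicat_real {j}"])
    then show "expectation (\<lambda>\<omega>. h (?r \<omega>) j * indicat_real {j} (?i \<omega>))
        = expectation (\<lambda>\<omega>. h (?r \<omega>) j) * (1 / real n)"
      using expectation_index_indicator[OF kt j] by simp
  qed
  also have "\<dots> = expectation (\<lambda>\<omega>. (1 / real n) * (\<Sum>j=1..n. h (?r \<omega>) j))"
    using integrable_past_function[OF kt, of "\<lambda>r. h r j" for j]
    by (subst integral_mult_right_zero, subst Bochner_Integration.integral_sum)
      (auto simp: sum_distrib_left mult.commute)
  finally show ?thesis .
qed

end

section \<open>Contraction of the expected squared distance\<close>

locale svrg_2bbs = bb_objective n f \<mu> L + uniform_index_sampling M n m I
  for n m :: nat and f :: "nat \<Rightarrow> real ^ 'd \<Rightarrow> real" and \<mu> L :: real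
    and M :: "'w measure" and I :: "nat \<Rightarrow> nat \<Rightarrow> 'w \<Rightarrow> nat" +
  fixes m\<^sub>1 :: real and \<xi> :: "nat \<Rightarrow> nat \<Rightarrow> real" and \<xi>_low \<xi>_high \<alpha> \<eta>\<^sub>0 \<eta>\<^sub>1 :: real
    and wm1 w0 z :: "real ^ 'd"
  assumes m1_pos: "m\<^sub>1 > 0" and low_pos: "0 < \<xi>_low"
    and \<xi>_range: "\<And>k t. k \<ge> 1 \<Longrightarrow> t \<in> {1..m} \<Longrightarrow> \<xi> k t \<in> {\<xi>_low<..<\<xi>_high}"
    and nondegenerate: "\<And>k. k \<ge> 1 \<Longrightarrow>
           AE \<omega> in M. snapshot n f m m\<^sub>1 \<xi> wm1 w0 (\<lambda>k t. I k t \<omega>) (k - 1)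
                     \<noteq> snapshot_prev n f m m\<^sub>1 \<xi> wm1 w0 (\<lambda>k t. I k t \<omega>) (k - 1)"
    and \<alpha>_pos: "\<alpha> > 0"
    and variance: "variance_condition M n f m m\<^sub>1 \<xi> wm1 w0 I \<alpha>"
    and \<eta>\<^sub>0_def: "\<eta>\<^sub>0 = \<xi>_low / (m\<^sub>1 * L)" and \<eta>\<^sub>1_def: "\<eta>\<^sub>1 = \<xi>_high / (m\<^sub>1 * \<mu>)"
    and margin: "1 - \<eta>\<^sub>1 * L * (2 * \<alpha> + 1) > 0"
    and rate_nonneg: "0 \<le> 1 - 2 * \<eta>\<^sub>0 * \<mu> * (1 - \<eta>\<^sub>1 * L * (2 * \<alpha> + 1))"
    and z_stationary: "grad F z = 0"
begin

abbreviation "draws \<omega> \<equiv> (\<lambda>k t. I k t \<omega>)"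
abbreviation "cur \<iota> k \<equiv> snapshot n f m m\<^sub>1 \<xi> wm1 w0 \<iota> (k - 1)"
abbreviation "prev \<iota> k \<equiv> snapshot_prev n f m m\<^sub>1 \<xi> wm1 w0 \<iota> (k - 1)"
abbreviation "iter \<iota> k t \<equiv> inner_iterate n f m m\<^sub>1 \<xi> wm1 w0 \<iota> k t"

definition rate where "rate = 1 - 2 * \<eta>\<^sub>0 * \<mu> * (1 - \<eta>\<^sub>1 * L * (2 * \<alpha> + 1))"

lemma \<eta>\<^sub>0_pos: "\<eta>\<^sub>0 > 0"
  using low_pos m1_pos L_pos by (simp add: \<eta>\<^sub>0_def)

lemma rate_less_1: "rate < 1"
  using \<eta>\<^sub>0_pos \<mu>_pos margin unfolding rate_def by simp

lemma iterates_from_past: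
  assumes "k \<ge> 1"
  shows "cur (draws \<omega>) k = cur (curry (past k t \<omega>)) k"
    and "prev (draws \<omega>) k = prev (curry (past k t \<omega>)) k"
    and "t \<in> {1..m} \<Longrightarrow> iter (draws \<omega>) k (t - 1) = iter (curry (past k t \<omega>)) k (t - 1)"
proof -
  have eq: "I j s \<omega> = curry (past k t \<omega>) j s" if "(j, s) \<in> past_indices m k t" for j s
    using that by (simp add: past_def)
  show "cur (draws \<omega>) k = cur (curry (past k t \<omega>)) k"
    using assms eq by (rule snapshot_cong_past)
  show "prev (draws \<omega>) k = prev (curry (past k t \<omega>)) k"
    using assms eq by (rule snapshot_prev_cong_past)
  show "iter (draws \<omega>) k (t - 1) = iter (curry (past k t \<omega>)) k (t - 1)" if "t \<in> {1..m}"
    using assms that eq by (rule inner_iterate_cong_past)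
qed

text \<open>
  The step size is itself random, but it is a function of the past.  The conditional bound therefore
  survives multiplication by its square before taking the full expectation.
\<close>

lemma weighted_residual_bound:
  fixes \<phi> :: "(nat \<times> nat \<Rightarrow> nat) \<Rightarrow> real"
  assumes kt: "k \<ge> 1" "t \<in> {1..m}" and \<phi>: "\<And>r. \<phi> r \<ge> 0"
  defines "p r \<equiv> prev (curry r) k" and "c r \<equiv> cur (curry r) k" and "w r \<equiv> iter (curry r) k (t - 1)"
  shows "expectation (\<lambda>\<omega>. \<phi> (past k t \<omega>) *
      (norm (svrg_residual f (p (past k t \<omega>)) (c (past k t \<omega>)) (I k t \<omega>) (w (past k t \<omega>))))\<^sup>2)
    \<le> \<alpha> * expectation (\<lambda>\<omega>. \<phi> (past k t \<omega>) *
      (norm (grad (f (I k t \<omega>)) (w (past k t \<omega>)) - grad (f (I k t \<omega>)) (c (past k t \<omega>))))\<^sup>2)"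
proof -
  interpret past: finite_measure_subalgebra M "past_algebra M m I k t"
    by unfold_locales (rule subalgebra_past)
  define X where "X \<omega> = (norm (svrg_residual f (p (past k t \<omega>)) (c (past k t \<omega>)) (I k t \<omega>) (w (past k t \<omega>))))\<^sup>2" for \<omega>
  define Y where "Y \<omega> = (norm (grad (f (I k t \<omega>)) (w (past k t \<omega>)) - grad (f (I k t \<omega>)) (c (past k t \<omega>))))\<^sup>2" for \<omega>
  let ?E = "real_cond_exp M (past_algebra M m I k t)"
  have meas: "(\<lambda>\<omega>. \<phi> (past k t \<omega>)) \<in> borel_measurable (past_algebra M m I k t)"
    "X \<in> borel_measurable M" "Y \<in> borel_measurable M"
    unfolding X_def Y_def
    using past_function_measurable_past
      past_index_function_measurable[OF kt, of "\<lambda>r i. (norm (svrg_residual f (p r) (c r) i (w r)))\<^sup>2"]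
      past_index_function_measurable[OF kt, of "\<lambda>r i. (norm (grad (f i) (w r) - grad (f i) (c r)))\<^sup>2"]
    by simp_all
  have int: "integrable M (\<lambda>\<omega>. \<phi> (past k t \<omega>) * X \<omega>)" "integrable M (\<lambda>\<omega>. \<phi> (past k t \<omega>) * Y \<omega>)"
    unfolding X_def Y_def
    using integrable_past_index_function[OF kt, of "\<lambda>r i. \<phi> r * (norm (svrg_residual f (p r) (c r) i (w r)))\<^sup>2"]
      integrable_past_index_function[OF kt, of "\<lambda>r i. \<phi> r * (norm (grad (f i) (w r) - grad (f i) (c r)))\<^sup>2"]
    by simp_all
  have "AE \<omega> in M. ?E X \<omega> \<le> \<alpha> * ?E Y \<omega>"
    using variance[unfolded variance_condition_def Let_def, rule_format, OF kt]
    unfolding X_def[abs_def] Y_def[abs_def] svrg_residual_def p_def c_def w_def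
    by (simp only: iterates_from_past(1,2)[OF kt(1), of _ t] iterates_from_past(3)[OF kt])
  then have AE: "AE \<omega> in M. \<phi> (past k t \<omega>) * ?E X \<omega> \<le> \<alpha> * (\<phi> (past k t \<omega>) * ?E Y \<omega>)"
    by eventually_elim (metis \<phi> mult.left_commute mult_left_mono)
  have "expectation (\<lambda>\<omega>. \<phi> (past k t \<omega>) * X \<omega>) = expectation (\<lambda>\<omega>. \<phi> (past k t \<omega>) * ?E X \<omega>)"
    by (rule past.real_cond_exp_intg(2)[OF int(1) meas(1,2), symmetric])
  also have "\<dots> \<le> expectation (\<lambda>\<omega>. \<alpha> * (\<phi> (past k t \<omega>) * ?E Y \<omega>))"
    using past.real_cond_exp_intg(1)[OF int(1) meas(1,2)] past.real_cond_exp_intg(1)[OF int(2) meas(1,3)]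
    by (intro integral_mono_AE AE integrable_mult_right)
  also have "\<dots> = \<alpha> * expectation (\<lambda>\<omega>. \<phi> (past k t \<omega>) * Y \<omega>)"
    using past.real_cond_exp_intg(2)[OF int(2) meas(1,3)] by simp
  finally show ?thesis unfolding X_def Y_def .
qed

text \<open>
  The bound on the step sizes holds only where the snapshots differ, so the contraction is applied
  almost everywhere and then integrated.
\<close>

lemma expected_inner_step:
  assumes kt: "k \<ge> 1" "t \<in> {1..m}"
  shows "expectation (\<lambda>\<omega>. (norm (iter (draws \<omega>) k t - z))\<^sup>2)
    \<le> rate * expectation (\<lambda>\<omega>. (norm (iter (draws \<omega>) k (t - 1) - z))\<^sup>2)
      + 2 * \<alpha> * \<eta>\<^sub>1\<^sup>2 * L\<^sup>2 * expectation (\<lambda>\<omega>. (norm (cur (draws \<omega>) k - z))\<^sup>2)"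
proof -
  define p where "p r = prev (curry r) k" for r
  define c where "c r = cur (curry r) k" for r
  define w where "w r = iter (curry r) k (t - 1)" for r
  define \<eta> where "\<eta> r = bb_step n f m\<^sub>1 (\<xi> k t) (p r) (c r)" for r
  define avg where "avg h = (1 / real n) * (\<Sum>j=1..n. h j)" for h :: "nat \<Rightarrow> real"
  define X where "X r i = (norm (svrg_residual f (p r) (c r) i (w r)))\<^sup>2" for r i
  define Y where "Y r i = (norm (grad (f i) (w r) - grad (f i) (c r)))\<^sup>2" for r i
  define D where "D r i = (norm (w r - \<eta> r *\<^sub>R svrg_direction n f (p r) (c r) i (w r) - z))\<^sup>2" for r i
  define G where "G r = (norm (w r - \<eta> r *\<^sub>R grad F (w r) - z))\<^sup>2" for r
  let ?r = "past k t" and ?i = "I k t"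
  note from_past = iterates_from_past(1,2)[OF kt(1), of _ t, folded p_def c_def]
    iterates_from_past(3)[OF kt, folded w_def]
  note [simp] = integrable_past_function[OF kt] integrable_past_index_function[OF kt]
  have fresh: "expectation (\<lambda>\<omega>. h (?r \<omega>) (?i \<omega>)) = expectation (\<lambda>\<omega>. avg (h (?r \<omega>)))" for h
    using expectation_fresh_index[OF kt, of h] by (simp only: avg_def)
  (* The variance condition speaks of the sampled index, so the average over all indices is turned
     back into a sampled one, bounded there, and averaged again. *)
  have second_moment: "expectation (\<lambda>\<omega>. (\<eta> (?r \<omega>))\<^sup>2 * avg (X (?r \<omega>)))
      \<le> \<alpha> * expectation (\<lambda>\<omega>. (\<eta> (?r \<omega>))\<^sup>2 * avg (Y (?r \<omega>)))"
  proof -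
    have "expectation (\<lambda>\<omega>. (\<eta> (?r \<omega>))\<^sup>2 * avg (X (?r \<omega>)))
        = expectation (\<lambda>\<omega>. (\<eta> (?r \<omega>))\<^sup>2 * X (?r \<omega>) (?i \<omega>))"
      unfolding fresh[of "\<lambda>r i. (\<eta> r)\<^sup>2 * X r i"] by (simp add: avg_def sum_distrib_left mult_ac)
    also have "\<dots> \<le> \<alpha> * expectation (\<lambda>\<omega>. (\<eta> (?r \<omega>))\<^sup>2 * Y (?r \<omega>) (?i \<omega>))"
      unfolding X_def Y_def p_def c_def w_def by (rule weighted_residual_bound[OF kt]) simp
    also have "expectation (\<lambda>\<omega>. (\<eta> (?r \<omega>))\<^sup>2 * Y (?r \<omega>) (?i \<omega>))
        = expectation (\<lambda>\<omega>. (\<eta> (?r \<omega>))\<^sup>2 * avg (Y (?r \<omega>)))"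
      unfolding fresh[of "\<lambda>r i. (\<eta> r)\<^sup>2 * Y r i"] by (simp add: avg_def sum_distrib_left mult_ac)
    finally show ?thesis .
  qed
  have "iter (draws \<omega>) k t
      = w (?r \<omega>) - \<eta> (?r \<omega>) *\<^sub>R svrg_direction n f (p (?r \<omega>)) (c (?r \<omega>)) (?i \<omega>) (w (?r \<omega>))" for \<omega>
    using inner_iterate_Suc[of n f m m\<^sub>1 \<xi> wm1 w0 "draws \<omega>" k "t - 1"] kt
    by (simp only: from_past \<eta>_def) simp
  then have "expectation (\<lambda>\<omega>. (norm (iter (draws \<omega>) k t - z))\<^sup>2) = expectation (\<lambda>\<omega>. D (?r \<omega>) (?i \<omega>))"
    by (simp only: D_def)
  also have "\<dots> = expectation (\<lambda>\<omega>. avg (D (?r \<omega>)))"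
    by (rule fresh)
  also have "\<dots> \<le> expectation (\<lambda>\<omega>. G (?r \<omega>) + (\<eta> (?r \<omega>))\<^sup>2 * avg (X (?r \<omega>)))"
    using integrable_past_function[OF kt, of "\<lambda>r. avg (D r)"]
      integrable_past_function[OF kt, of "\<lambda>r. G r + (\<eta> r)\<^sup>2 * avg (X r)"]
  proof (rule integral_mono)
    show "avg (D (?r \<omega>)) \<le> G (?r \<omega>) + (\<eta> (?r \<omega>))\<^sup>2 * avg (X (?r \<omega>))" for \<omega>
      unfolding avg_def D_def G_def X_def by (rule avg_svrg_step)
  qed
  also have "\<dots> = expectation (\<lambda>\<omega>. G (?r \<omega>)) + expectation (\<lambda>\<omega>. (\<eta> (?r \<omega>))\<^sup>2 * avg (X (?r \<omega>)))"
    using integrable_past_function[OF kt, of "\<lambda>r. (\<eta> r)\<^sup>2 * avg (X r)"]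
    by (intro Bochner_Integration.integral_add) simp_all
  also have "\<dots> \<le> expectation (\<lambda>\<omega>. G (?r \<omega>))
      + \<alpha> * expectation (\<lambda>\<omega>. (\<eta> (?r \<omega>))\<^sup>2 * avg (Y (?r \<omega>)))"
    using second_moment by simp
  also have "\<dots> = expectation (\<lambda>\<omega>. G (?r \<omega>) + \<alpha> * ((\<eta> (?r \<omega>))\<^sup>2 * avg (Y (?r \<omega>))))"
    using integrable_past_function[OF kt, of "\<lambda>r. \<alpha> * ((\<eta> r)\<^sup>2 * avg (Y r))"]
    by (subst Bochner_Integration.integral_add) simp_all
  also have "\<dots> \<le> expectation (\<lambda>\<omega>. rate * (norm (w (?r \<omega>) - z))\<^sup>2
      + 2 * \<alpha> * \<eta>\<^sub>1\<^sup>2 * L\<^sup>2 * (norm (c (?r \<omega>) - z))\<^sup>2)"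
    using integrable_past_function[OF kt, of "\<lambda>r. G r + \<alpha> * ((\<eta> r)\<^sup>2 * avg (Y r))"]
      integrable_past_function[OF kt, of "\<lambda>r. rate * (norm (w r - z))\<^sup>2
        + 2 * \<alpha> * \<eta>\<^sub>1\<^sup>2 * L\<^sup>2 * (norm (c r - z))\<^sup>2"]
  proof (rule integral_mono_AE)
    show "AE \<omega> in M. G (?r \<omega>) + \<alpha> * ((\<eta> (?r \<omega>))\<^sup>2 * avg (Y (?r \<omega>)))
        \<le> rate * (norm (w (?r \<omega>) - z))\<^sup>2 + 2 * \<alpha> * \<eta>\<^sub>1\<^sup>2 * L\<^sup>2 * (norm (c (?r \<omega>) - z))\<^sup>2"
      using nondegenerate[OF kt(1)]
    proof eventually_elim
      case (elim \<omega>)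
      then have "c (?r \<omega>) \<noteq> p (?r \<omega>)"
        unfolding from_past .
      from bb_step_bounds[OF this m1_pos \<xi>_range[OF kt] low_pos]
      have "\<eta>\<^sub>0 \<le> \<eta> (?r \<omega>)" "\<eta> (?r \<omega>) \<le> \<eta>\<^sub>1"
        by (simp_all only: \<eta>_def \<eta>\<^sub>0_def \<eta>\<^sub>1_def)
      from descent_with_variance_contracts[OF z_stationary \<alpha>_pos this \<eta>\<^sub>0_pos margin]
      show ?case
        unfolding G_def avg_def Y_def rate_def mult.assoc[of \<alpha> "(\<eta> (?r \<omega>))\<^sup>2", symmetric] .
    qed
  qed
  also have "\<dots> = rate * expectation (\<lambda>\<omega>. (norm (w (?r \<omega>) - z))\<^sup>2)
      + 2 * \<alpha> * \<eta>\<^sub>1\<^sup>2 * L\<^sup>2 * expectation (\<lambda>\<omega>. (norm (c (?r \<omega>) - z))\<^sup>2)"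
    using integrable_past_function[OF kt, of "\<lambda>r. (norm (w r - z))\<^sup>2"]
      integrable_past_function[OF kt, of "\<lambda>r. (norm (c r - z))\<^sup>2"]
    by (subst Bochner_Integration.integral_add) simp_all
  finally show ?thesis
    unfolding from_past .
qed

lemma expected_epoch:
  assumes k: "k \<ge> 1"
  shows "expectation (\<lambda>\<omega>. (norm (snapshot n f m m\<^sub>1 \<xi> wm1 w0 (draws \<omega>) k - z))\<^sup>2)
    \<le> (rate ^ m + 2 * \<alpha> * \<eta>\<^sub>1\<^sup>2 * L\<^sup>2 / (1 - rate))
      * expectation (\<lambda>\<omega>. (norm (cur (draws \<omega>) k - z))\<^sup>2)"
proof -
  define e where "e = expectation (\<lambda>\<omega>. (norm (cur (draws \<omega>) k - z))\<^sup>2)"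
  define K where "K = 2 * \<alpha> * \<eta>\<^sub>1\<^sup>2 * L\<^sup>2"
  have nonneg: "e \<ge> 0" "K \<ge> 0" "0 \<le> rate"
    using \<alpha>_pos rate_nonneg by (auto simp: e_def K_def rate_def)
  (* K / (1 - rate) * e is the fixed point of the map sending x to rate * x + K * e, so it absorbs
     the errors of all inner steps. *)
  have "expectation (\<lambda>\<omega>. (norm (iter (draws \<omega>) k t - z))\<^sup>2) \<le> (rate ^ t + K / (1 - rate)) * e"
    if "t \<le> m" for t
    using that
  proof (induction t)
    case 0
    have "e \<le> (1 + K / (1 - rate)) * e"
      using nonneg rate_less_1 by (simp add: distrib_right)
    then show ?case
      by (simp add: inner_iterate_0 e_def)
  next
    case (Suc t)
    have "expectation (\<lambda>\<omega>. (norm (iter (draws \<omega>) k (Suc t) - z))\<^sup>2)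
        \<le> rate * expectation (\<lambda>\<omega>. (norm (iter (draws \<omega>) k t - z))\<^sup>2) + K * e"
      using expected_inner_step[OF k, of "Suc t"] Suc.prems by (simp add: K_def e_def)
    also have "\<dots> \<le> rate * ((rate ^ t + K / (1 - rate)) * e) + K * e"
      using Suc nonneg by (intro add_right_mono mult_left_mono) auto
    also have "\<dots> = (rate ^ Suc t + K / (1 - rate)) * e"
      using rate_less_1 by (simp add: field_simps)
    finally show ?case .
  qed
  from this[of m] show ?thesis
    by (simp add: inner_iterate_last[OF k] e_def K_def)
qed

lemma expected_snapshot_distance:
  "expectation (\<lambda>\<omega>. (norm (snapshot n f m m\<^sub>1 \<xi> wm1 w0 (draws \<omega>) k - z))\<^sup>2)
    \<le> (rate ^ m + 2 * \<alpha> * \<eta>\<^sub>1\<^sup>2 * L\<^sup>2 / (1 - rate)) ^ k * (norm (w0 - z))\<^sup>2"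
proof (induction k)
  case 0
  then show ?case by (simp add: snapshot_def prob_space)
next
  case (Suc k)
  let ?\<gamma> = "rate ^ m + 2 * \<alpha> * \<eta>\<^sub>1\<^sup>2 * L\<^sup>2 / (1 - rate)"
  have "?\<gamma> \<ge> 0"
    using rate_nonneg rate_less_1 \<alpha>_pos by (simp add: rate_def)
  then have "?\<gamma> * expectation (\<lambda>\<omega>. (norm (snapshot n f m m\<^sub>1 \<xi> wm1 w0 (draws \<omega>) k - z))\<^sup>2)
      \<le> ?\<gamma> * (?\<gamma> ^ k * (norm (w0 - z))\<^sup>2)"
    by (rule mult_left_mono[OF Suc.IH])
  with expected_epoch[of "Suc k"] show ?case by simp
qed

end

theorem theorem4p3:
  fixes n m :: nat
    and f :: "nat \<Rightarrow> real ^ 'd \<Rightarrow> real"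
    and \<mu>s :: "nat \<Rightarrow> real" and L m\<^sub>1 :: real
    and \<xi> :: "nat \<Rightarrow> nat \<Rightarrow> real" and \<xi>_low \<xi>_high \<alpha> :: real
    and F :: "real ^ 'd \<Rightarrow> real" and \<mu> \<eta>\<^sub>0 \<eta>\<^sub>1 :: real
    and wm1 w0 wstar :: "real ^ 'd"
    and M :: "'w measure" and I :: "nat \<Rightarrow> nat \<Rightarrow> 'w \<Rightarrow> nat"
  assumes "F = avg_fun n f"
    and "\<mu> = Min (\<mu>s ` {1..n})"
    and "\<eta>\<^sub>0 = \<xi>_low / (m\<^sub>1 * L)"
    and "\<eta>\<^sub>1 = \<xi>_high / (m\<^sub>1 * \<mu>)"
    and "n \<ge> 1" and "m \<ge> 1" and "m\<^sub>1 > 0"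
    and "\<And>i. i \<in> {1..n} \<Longrightarrow> twice_cont_diff (f i)"
    and "\<And>i. i \<in> {1..n} \<Longrightarrow> \<mu>s i > 0"
    and "\<And>i. i \<in> {1..n} \<Longrightarrow> strong_convexity (f i) (\<mu>s i)"
    and "L > 0"
    and "\<And>i. i \<in> {1..n} \<Longrightarrow> lipschitz_grad (f i) L"
    and "0 < \<xi>_low" and "\<xi>_low \<le> \<xi>_high"
    and "\<And>k t. k \<ge> 1 \<Longrightarrow> t \<in> {1..m} \<Longrightarrow> \<xi> k t \<in> {\<xi>_low<..<\<xi>_high}"
    and "prob_space M"
    and "uniform_iid_indices M n m I"
    and "wm1 \<noteq> w0"
    and "\<And>k. k \<ge> 1 \<Longrightarrow>
           AE \<omega> in M. snapshot n f m m\<^sub>1 \<xi> wm1 w0 (\<lambda>k t. I k t \<omega>) (k - 1)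
                     \<noteq> snapshot_prev n f m m\<^sub>1 \<xi> wm1 w0 (\<lambda>k t. I k t \<omega>) (k - 1)"
    and "\<alpha> > 0"
    and "variance_condition M n f m m\<^sub>1 \<xi> wm1 w0 I \<alpha>"
    and "1 - \<eta>\<^sub>1 * L * (2 * \<alpha> + 1) > 0"
    and "1 - 2 * \<eta>\<^sub>0 * \<mu> * (1 - \<eta>\<^sub>1 * L * (2 * \<alpha> + 1)) \<in> {0..<1}"
    and "is_arg_min F (\<lambda>_. True) wstar"
  shows "\<forall>k\<ge>1.
    prob_space.expectation M
        (\<lambda>\<omega>. (norm (snapshot n f m m\<^sub>1 \<xi> wm1 w0 (\<lambda>k t. I k t \<omega>) k - wstar))\<^sup>2)
    \<le> ((1 - 2 * \<eta>\<^sub>0 * \<mu> * (1 - \<eta>\<^sub>1 * L * (2 * \<alpha> + 1))) ^ m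
         + 2 * \<alpha> * \<eta>\<^sub>1\<^sup>2 * L\<^sup>2 / (\<eta>\<^sub>0 * \<mu> * (1 - \<eta>\<^sub>1 * L * (2 * \<alpha> + 1)))) ^ k
       * (norm (w0 - wstar))\<^sup>2"
proof (intro allI impI)
  fix k :: nat
  have \<mu>_le: "\<mu> \<le> \<mu>s i" if "i \<in> {1..n}" for i
    using that unfolding assms(2) by (intro Min_le) auto
  have \<mu>_pos: "\<mu> > 0"
    using assms(5,9) unfolding assms(2) by (subst Min_gr_iff) auto
  have conv: "strong_convexity (f i) \<mu>" if "i \<in> {1..n}" for i
    unfolding strong_convexity_def
  proof (intro allI)
    fix w z :: "real ^ 'd"
    have "\<mu> / 2 * (norm (z - w))\<^sup>2 \<le> \<mu>s i / 2 * (norm (z - w))\<^sup>2"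
      using \<mu>_le[OF that] by (intro mult_right_mono) auto
    with assms(10)[OF that] show "f i w \<ge> f i z + grad (f i) z \<bullet> (w - z) + \<mu> / 2 * (norm (z - w))\<^sup>2"
      unfolding strong_convexity_def by (meson add_left_mono order_trans)
  qed
  interpret obj: bb_objective n f \<mu> L
  proof
    show "n \<ge> 1" "\<mu> > 0" "L > 0"
      by fact+
    show "GDERIV (f i) x :> grad (f i) x" "strong_convexity (f i) \<mu>" "lipschitz_grad (f i) L"
      if "i \<in> {1..n}" for i x
      using that assms(8,12) conv twice_cont_diff_GDERIV by blast+
  qed
  interpret uniform_index_sampling M n m I
    using assms(5,16,17) by (intro uniform_index_sampling.intro uniform_index_sampling_axioms.intro)
  have stationary: "grad (avg_fun n f) wstar = 0"
    using grad_at_minimizer[OF obj.F_GDERIV_grad obj.F_lip assms(11)] assms(1,24) by blast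
  interpret svrg_2bbs n m f \<mu> L M I m\<^sub>1 \<xi> \<xi>_low \<xi>_high \<alpha> \<eta>\<^sub>0 \<eta>\<^sub>1 wm1 w0 wstar
    using assms(3,4,7,13,15,19-23) stationary by unfold_locales auto
  define q where "q = 1 - \<eta>\<^sub>1 * L * (2 * \<alpha> + 1)"
  define K where "K = 2 * \<alpha> * \<eta>\<^sub>1\<^sup>2 * L\<^sup>2"
  have rate: "rate = 1 - 2 * \<eta>\<^sub>0 * \<mu> * q"
    by (simp add: rate_def q_def)
  have pos: "\<eta>\<^sub>0 * \<mu> * q > 0"
    using \<eta>\<^sub>0_pos \<mu>_pos margin by (simp add: q_def)
  have K: "K \<ge> 0"
    using \<alpha>_pos by (simp add: K_def)
  (* Summing the errors of the inner steps gives the denominator 1 - rate, which is twice the one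
     claimed. *)
  have "K / (1 - rate) \<le> K / (\<eta>\<^sub>0 * \<mu> * q)"
    using pos K by (intro divide_left_mono) (auto simp: rate)
  moreover have "0 \<le> rate ^ m" "0 \<le> K / (1 - rate)"
    using rate_nonneg K rate_less_1 by (auto simp: rate_def)
  ultimately have "(rate ^ m + K / (1 - rate)) ^ k * (norm (w0 - wstar))\<^sup>2
      \<le> (rate ^ m + K / (\<eta>\<^sub>0 * \<mu> * q)) ^ k * (norm (w0 - wstar))\<^sup>2"
    by (intro mult_right_mono power_mono) auto
  with expected_snapshot_distance[of k]
  show "expectation (\<lambda>\<omega>. (norm (snapshot n f m m\<^sub>1 \<xi> wm1 w0 (\<lambda>k t. I k t \<omega>) k - wstar))\<^sup>2)
    \<le> ((1 - 2 * \<eta>\<^sub>0 * \<mu> * (1 - \<eta>\<^sub>1 * L * (2 * \<alpha> + 1))) ^ m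
         + 2 * \<alpha> * \<eta>\<^sub>1\<^sup>2 * L\<^sup>2 / (\<eta>\<^sub>0 * \<mu> * (1 - \<eta>\<^sub>1 * L * (2 * \<alpha> + 1)))) ^ k
       * (norm (w0 - wstar))\<^sup>2"
    unfolding K_def[symmetric] q_def[symmetric] rate[symmetric] by (rule order_trans)
qed

end
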